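(* Let $Y$ be a contractible, locally finite $d$-dimensional simplicial complex and let $G =\{S_1, \dots, S_n\}$ be a good cover in $\|Y\|$. Suppose $K$ is a simplicial complex on $n$ vertices (with vertex set $[n]=\{1,\dots,n\}$) which is a subcomplex of the nerve of $G$. Then there exist an integer $m$, a family of convex sets $F = \{C_1, \dots, C_n\}$ in $\mathbb{R}^{m}$ and a continuous map $f \colon \mathbb{R}^{m} \to \|Y\|$ such that the following hold. (1) The nerve of $F$ equals $K$ (with $C_i$ corresponding to the vertex $i$). (2) For every $i\in [n]$ we have $f(C_i)\subset S_i$.
   Context: For a (locally finite) simplicial complex $Y$, $\|Y\|$ denotes its polyhedron: the underlying topological space, i.e. the union of its simplices with the topology induced by the geometric realization. A good cover in a topological space is a finite family of compact subsets of the space such that the intersection of any subfamily is either empty or contractible (the family is not required to cover the space). The nerve of a finite family $\{A_1,\dots,A_n\}$ is the simplicial complex whose faces are the sets $\sigma\subset[n]$ with $\bigcap_{i\in\sigma}A_i\neq\emptyset$. *)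

theory Defs
  imports "HOL-Analysis.Analysis"
begin

text \<open>
  Abstract simplicial complexes contain the empty face. This matches \<open>nerve\<close> below, where
  the empty intersection is \<open>UNIV\<close>, so that the empty set is always a face of a nerve.
\<close>

definition simplicial_complex_abs :: "'v set set \<Rightarrow> bool" where
  "simplicial_complex_abs K \<longleftrightarrow>
     {} \<in> K \<and> (\<forall>\<sigma>\<in>K. finite \<sigma>) \<and> (\<forall>\<sigma>\<in>K. \<forall>\<tau>. \<tau> \<subseteq> \<sigma> \<longrightarrow> \<tau> \<in> K)"

definition vertex_set :: "'v set set \<Rightarrow> 'v set" where
  "vertex_set K = \<Union>K"

definition locally_finite_complex :: "'v set set \<Rightarrow> bool" where
  "locally_finite_complex K \<longleftrightarrow> (\<forall>v\<in>vertex_set K. finite {\<sigma>\<in>K. v \<in> \<sigma>})"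

text \<open>
  Since \<open>d\<close> is a natural number, a \<open>d\<close>-dimensional complex has a nonempty face. In particular its
  polyhedron is nonempty, which matters because \<^const>\<open>contractible_space\<close> holds for the empty
  space.
\<close>

definition complex_dim :: "'v set set \<Rightarrow> nat \<Rightarrow> bool" where
  "complex_dim K d \<longleftrightarrow> (\<forall>\<sigma>\<in>K. card \<sigma> \<le> d + 1) \<and> (\<exists>\<sigma>\<in>K. card \<sigma> = d + 1)"

text \<open>
  Points of the geometric realization are given by their barycentric coordinates
  \<open>x :: 'v \<Rightarrow> real\<close>. The topology is the one coherent with the closed simplices, each of which
  has its Euclidean topology (the subspace topology of the product topology on \<open>'v \<Rightarrow> real\<close>).
  For locally finite complexes it coincides with the metric topology.
\<close>

definition closed_simplex :: "'v set \<Rightarrow> ('v \<Rightarrow> real) set" where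
  "closed_simplex \<sigma> = {x. (\<forall>v. 0 \<le> x v) \<and> (\<forall>v. v \<notin> \<sigma> \<longrightarrow> x v = 0) \<and> sum x \<sigma> = 1}"

definition polyhedron_top :: "'v set set \<Rightarrow> ('v \<Rightarrow> real) topology" where
  "polyhedron_top K = topology (\<lambda>U. U \<subseteq> (\<Union>\<sigma>\<in>K. closed_simplex \<sigma>) \<and>
     (\<forall>\<sigma>\<in>K. openin (top_of_set (closed_simplex \<sigma>)) (U \<inter> closed_simplex \<sigma>)))"

lemma openin_polyhedron_top:
  "openin (polyhedron_top K) U \<longleftrightarrow> U \<subseteq> (\<Union>\<sigma>\<in>K. closed_simplex \<sigma>) \<and>
     (\<forall>\<sigma>\<in>K. openin (top_of_set (closed_simplex \<sigma>)) (U \<inter> closed_simplex \<sigma>))"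
proof -
  let ?P = "\<lambda>U. U \<subseteq> (\<Union>\<sigma>\<in>K. closed_simplex \<sigma>) \<and>
     (\<forall>\<sigma>\<in>K. openin (top_of_set (closed_simplex \<sigma>)) (U \<inter> closed_simplex \<sigma>))"
  have "istopology ?P"
    unfolding istopology_def
  proof (intro conjI allI impI)
    fix S T assume S: "?P S" and T: "?P T"
    have eq: "S \<inter> T \<inter> closed_simplex \<sigma> = (S \<inter> closed_simplex \<sigma>) \<inter> (T \<inter> closed_simplex \<sigma>)" for \<sigma>
      by auto
    show "S \<inter> T \<subseteq> (\<Union>\<sigma>\<in>K. closed_simplex \<sigma>)"
      using S by auto
    show "\<forall>\<sigma>\<in>K. openin (top_of_set (closed_simplex \<sigma>)) (S \<inter> T \<inter> closed_simplex \<sigma>)"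
      unfolding eq using S T by (blast intro: openin_Int)
  next
    fix \<U> assume \<U>: "\<forall>U\<in>\<U>. ?P U"
    have eq: "\<Union>\<U> \<inter> closed_simplex \<sigma> = (\<Union>U\<in>\<U>. U \<inter> closed_simplex \<sigma>)" for \<sigma>
      by auto
    show "\<Union>\<U> \<subseteq> (\<Union>\<sigma>\<in>K. closed_simplex \<sigma>)"
      using \<U> by auto
    show "\<forall>\<sigma>\<in>K. openin (top_of_set (closed_simplex \<sigma>)) (\<Union>\<U> \<inter> closed_simplex \<sigma>)"
      unfolding eq using \<U> by (blast intro: openin_Union)
  qed
  then show ?thesis
    unfolding polyhedron_top_def by (simp add: topology_inverse')
qed

lemma topspace_polyhedron_top: "topspace (polyhedron_top K) = (\<Union>\<sigma>\<in>K. closed_simplex \<sigma>)"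
proof
  show "topspace (polyhedron_top K) \<subseteq> (\<Union>\<sigma>\<in>K. closed_simplex \<sigma>)"
    using openin_topspace[of "polyhedron_top K"] unfolding openin_polyhedron_top by blast
  have "openin (polyhedron_top K) (\<Union>\<sigma>\<in>K. closed_simplex \<sigma>)"
    unfolding openin_polyhedron_top
  proof (intro conjI ballI)
    fix \<sigma> assume "\<sigma> \<in> K"
    then have "(\<Union>\<tau>\<in>K. closed_simplex \<tau>) \<inter> closed_simplex \<sigma> = closed_simplex \<sigma>"
      by auto
    then show "openin (top_of_set (closed_simplex \<sigma>)) ((\<Union>\<tau>\<in>K. closed_simplex \<tau>) \<inter> closed_simplex \<sigma>)"
      by (simp add: openin_subtopology_self)
  qed simp
  then show "(\<Union>\<sigma>\<in>K. closed_simplex \<sigma>) \<subseteq> topspace (polyhedron_top K)"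
    by (rule openin_subset)
qed

definition nerve :: "nat \<Rightarrow> (nat \<Rightarrow> 'a set) \<Rightarrow> nat set set" where
  "nerve n A = {\<sigma>. \<sigma> \<subseteq> {1..n} \<and> (\<Inter>i\<in>\<sigma>. A i) \<noteq> {}}"

definition good_cover :: "'a topology \<Rightarrow> nat \<Rightarrow> (nat \<Rightarrow> 'a set) \<Rightarrow> bool" where
  "good_cover X n S \<longleftrightarrow>
     (\<forall>i\<in>{1..n}. compactin X (S i)) \<and>
     (\<forall>J. J \<noteq> {} \<and> J \<subseteq> {1..n} \<longrightarrow>
        (\<Inter>i\<in>J. S i) = {} \<or> contractible_space (subtopology X (\<Inter>i\<in>J. S i)))"

text \<open>
  The dimension of the Euclidean space is existentially quantified, so it is modelled by
  \<^const>\<open>Euclidean_space\<close>. Its points are functions \<open>nat \<Rightarrow> real\<close>, which form no instance of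
  class \<^class>\<open>real_vector\<close>; the following is \<^const>\<open>convex\<close> written out in coordinates.
\<close>

definition convex_in_Euclidean :: "nat \<Rightarrow> (nat \<Rightarrow> real) set \<Rightarrow> bool" where
  "convex_in_Euclidean m C \<longleftrightarrow> C \<subseteq> topspace (Euclidean_space m) \<and>
     (\<forall>x\<in>C. \<forall>y\<in>C. \<forall>u\<ge>0. \<forall>v\<ge>0. u + v = 1 \<longrightarrow> (\<lambda>i. u * x i + v * y i) \<in> C)"

end

theory Submission
  imports Defs
begin

text \<open>
  Let \<open>m = card K\<close>, index the faces of \<open>K\<close> by the vertices of the standard simplex in
  \<open>\<real>\<^sup>m\<close>, and let \<open>C\<^sub>i\<close> be the face of that simplex spanned by the vertices whose label contains \<open>i\<close>.
  Then \<open>\<Inter>\<^bsub>i\<in>\<tau>\<^esub> C\<^sub>i\<close> is the face spanned by the labels containing \<open>\<tau>\<close>, so the nerve is \<open>K\<close>.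
  To a face spanned by a set of labels with intersection \<open>\<rho>\<close> assign the contractible set
  \<open>\<Inter>\<^bsub>i\<in>\<rho>\<^esub> S\<^sub>i\<close> (the whole polyhedron if \<open>\<rho> = {}\<close>). This assignment is monotone, so a map carried by
  it is built face by face: a map from the boundary of a simplex to a contractible space extends
  over the simplex. Finally, compose with a retraction of \<open>\<real>\<^sup>m\<close> onto the simplex.
\<close>

section \<open>Faces of a simplex in barycentric coordinates\<close>

lemma closed_simplex_empty [simp]: "closed_simplex {} = {}"
  by (auto simp: closed_simplex_def)

lemma closed_closed_simplex: "closed (closed_simplex T)"
  unfolding closed_simplex_def
  by (intro closed_Collect_conj closed_Collect_all closed_Collect_imp closed_Collect_le
      closed_Collect_eq continuous_intros) auto

lemma closed_simplex_mono:
  assumes "finite T" "U \<subseteq> T"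
  shows "closed_simplex U \<subseteq> closed_simplex T"
proof
  fix x assume x: "x \<in> closed_simplex U"
  then have "sum x T = sum x U"
    using assms by (intro sum.mono_neutral_right) (auto simp: closed_simplex_def)
  then show "x \<in> closed_simplex T"
    using x assms by (auto simp: closed_simplex_def)
qed

lemma closed_simplex_subface:
  assumes "finite T" "x \<in> closed_simplex T" "U \<subseteq> T" "\<And>i. i \<in> T - U \<Longrightarrow> x i = 0"
  shows "x \<in> closed_simplex U"
proof -
  have "sum x T = sum x U"
    using assms by (intro sum.mono_neutral_right) auto
  then show ?thesis
    using assms by (auto simp: closed_simplex_def)
qed

text \<open>A point common to all these faces has coordinate 0 at every vertex missing from at least
  one of them, so it is supported on the common vertices.\<close>

lemma INT_closed_simplex:
  assumes "finite V" "I \<noteq> {}"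
  shows "(\<Inter>i\<in>I. closed_simplex {v\<in>V. P i v}) = closed_simplex {v\<in>V. \<forall>i\<in>I. P i v}"
proof
  show "closed_simplex {v\<in>V. \<forall>i\<in>I. P i v} \<subseteq> (\<Inter>i\<in>I. closed_simplex {v\<in>V. P i v})"
    using assms by (intro INT_greatest closed_simplex_mono) auto
  show "(\<Inter>i\<in>I. closed_simplex {v\<in>V. P i v}) \<subseteq> closed_simplex {v\<in>V. \<forall>i\<in>I. P i v}"
  proof
    fix x assume x: "x \<in> (\<Inter>i\<in>I. closed_simplex {v\<in>V. P i v})"
    obtain i where i: "i \<in> I" using assms by auto
    show "x \<in> closed_simplex {v\<in>V. \<forall>i\<in>I. P i v}"
    proof (rule closed_simplex_subface[of "{v\<in>V. P i v}"])
      fix v assume v: "v \<in> {v \<in> V. P i v} - {v \<in> V. \<forall>i\<in>I. P i v}"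
      then obtain j where "j \<in> I" "\<not> P j v" by auto
      with x show "x v = 0" by (auto simp: closed_simplex_def)
    qed (use assms i x in auto)
  qed
qed

lemma closed_simplex_eq_empty_iff:
  assumes "finite T"
  shows "closed_simplex T = {} \<longleftrightarrow> T = {}"
proof -
  have "(\<lambda>j. if j = i then 1 else 0) \<in> closed_simplex T" if "i \<in> T" for i
    using that assms by (auto simp: closed_simplex_def)
  then show ?thesis by fastforce
qed

section \<open>Extending maps over simplices with contractible targets\<close>

lemma continuous_on_Min_image:
  fixes f :: "'i \<Rightarrow> 'a::topological_space \<Rightarrow> real"
  assumes "finite I" "I \<noteq> {}" "\<And>i. i \<in> I \<Longrightarrow> continuous_on A (f i)"
  shows "continuous_on A (\<lambda>x. Min ((\<lambda>i. f i x) ` I))"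
  using assms by (induction rule: finite_ne_induct) (auto intro!: continuous_on_min)

text \<open>A simplex is the cone from its barycenter over its boundary. Moving inwards along a ray,
  the boundary value of \<open>g\<close> is pushed along a contraction of \<open>Z\<close>. For a
  single vertex the boundary is empty and \<open>h\<close> is constant.\<close>

lemma continuous_map_extend_over_simplex:
  fixes T :: "'i set"
  assumes T: "finite T" "T \<noteq> {}" and Z: "contractible_space Z" "topspace Z \<noteq> {}"
    and g: "continuous_map (top_of_set {x\<in>closed_simplex T. \<exists>i\<in>T. x i = 0}) Z g"
  obtains h where "continuous_map (top_of_set (closed_simplex T)) Z h"
    and "\<And>x i. \<lbrakk>x \<in> closed_simplex T; i \<in> T; x i = 0\<rbrakk> \<Longrightarrow> h x = g x"
proof -
  define B where "B = {x\<in>closed_simplex T. \<exists>i\<in>T. x i = 0}"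
  obtain a H where H: "continuous_map (prod_topology (top_of_set {0..1::real}) Z) Z H"
    and H0: "\<And>z. H (0, z) = z" and H1: "\<And>z. H (1, z) = a"
    using Z unfolding contractible_space_def homotopic_with_def by auto
  obtain z0 where z0: "z0 \<in> topspace Z" using Z(2) by blast
  have a: "a \<in> topspace Z"
    using continuous_map_image_subset_topspace[OF H] H1[of z0] z0
    by (force simp: image_subset_iff)
  define mn where "mn x = Min (x ` T)" for x :: "'i \<Rightarrow> real"
  \<comment> \<open>The weight of the barycenter \<open>b\<close> in the cone coordinates
    \<open>x = \<mu> x * b + (1 - \<mu> x) * y x\<close>: it is 0 on the boundary and 1 at
    \<open>b\<close>.\<close>
  define \<mu> where "\<mu> x = real (card T) * mn x" for x :: "'i \<Rightarrow> real"
  define A where "A = {x\<in>closed_simplex T. \<mu> x \<le> 1/2}"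
  text \<open>Radial projection from the barycenter to the boundary. It breaks down at the barycenter,
    hence the restriction to \<open>A\<close>: the contraction is already completed on the half-size simplex.\<close>
  define y where "y x = (\<lambda>i. if i \<in> T then (x i - mn x) / (1 - \<mu> x) else 0)" for x :: "'i \<Rightarrow> real"
  have mn_le: "mn x \<le> x i" if "i \<in> T" for x i
    using T that by (auto simp: mn_def)
  have mn_attained: "\<exists>i\<in>T. x i = mn x" for x
  proof -
    have "mn x \<in> x ` T" unfolding mn_def using T by (intro Min_in) auto
    then show ?thesis by auto
  qed
  have mn_ge: "0 \<le> mn x" if "x \<in> closed_simplex T" for x
    using mn_attained[of x] that by (auto simp: closed_simplex_def) metis
  have \<mu>_ge: "0 \<le> \<mu> x" if "x \<in> closed_simplex T" for x
    using mn_ge[OF that] by (simp add: \<mu>_def)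
  have cont_coord: "continuous_on C (\<lambda>x. x i)" for C and i :: 'i
    by (rule continuous_on_product_then_coordinatewise) (rule continuous_on_id)
  have cont_mn: "continuous_on C mn" for C
    unfolding mn_def
    using T by (intro continuous_on_Min_image cont_coord) auto
  have cont_\<mu>: "continuous_on C \<mu>" for C
    unfolding \<mu>_def by (intro continuous_intros cont_mn)
  have cont_y: "continuous_on A y"
  proof (rule continuous_on_coordinatewise_then_product)
    fix i
    show "continuous_on A (\<lambda>x. y x i)"
      unfolding y_def
      by (cases "i \<in> T") (auto simp: A_def intro!: continuous_intros cont_mn cont_\<mu> cont_coord)
  qed
  have y_in: "y x \<in> B" if x: "x \<in> A" for x
  proof -
    have pos: "1 - \<mu> x > 0" and xs: "x \<in> closed_simplex T" using x by (auto simp: A_def)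
    have "sum (y x) T = (\<Sum>i\<in>T. x i - mn x) / (1 - \<mu> x)"
      by (simp add: y_def sum_divide_distrib)
    also have "(\<Sum>i\<in>T. x i - mn x) = 1 - \<mu> x"
      using xs by (simp add: sum_subtractf \<mu>_def closed_simplex_def)
    finally have "sum (y x) T = 1" using pos by simp
    moreover have "0 \<le> y x i" for i
      using pos mn_le by (auto simp: y_def)
    moreover obtain i where "i \<in> T" "x i = mn x" using mn_attained by blast
    ultimately show ?thesis
      by (auto simp: B_def closed_simplex_def y_def)
  qed
  \<comment> \<open>The factor 2 ends the contraction at \<open>\<mu> x = 1/2\<close>, where both
    branches equal \<open>a\<close>. On the boundary \<open>\<mu> x = 0\<close> and
    \<open>y x = x\<close>, so \<open>H\<close> returns \<open>g x\<close>.\<close>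
  define h where "h x = (if \<mu> x \<le> 1/2 then H (2 * \<mu> x, g (y x)) else a)" for x
  have "continuous_map (top_of_set (closed_simplex T)) Z h"
    unfolding h_def
  proof (rule continuous_map_cases_le)
    show "continuous_map (top_of_set (closed_simplex T)) euclideanreal \<mu>"
      using cont_\<mu> by simp
    have "continuous_map (top_of_set A) (top_of_set B) y"
      using cont_y y_in by (auto simp: continuous_map_in_subtopology)
    then have gy: "continuous_map (top_of_set A) Z (\<lambda>x. g (y x))"
      using continuous_map_compose g unfolding B_def comp_def by blast
    have "continuous_map (top_of_set A) (top_of_set {0..1}) (\<lambda>x. 2 * \<mu> x)"
      using \<mu>_ge by (auto simp: continuous_map_in_subtopology A_def
          intro!: continuous_intros cont_\<mu>)
    with gy have "continuous_map (top_of_set A) (prod_topology (top_of_set {0..1}) Z)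
        (\<lambda>x. (2 * \<mu> x, g (y x)))"
      by (simp add: continuous_map_pairedI)
    from continuous_map_compose[OF this H]
    have "continuous_map (top_of_set A) Z (\<lambda>x. H (2 * \<mu> x, g (y x)))"
      by (simp add: comp_def)
    moreover have "closed_simplex T \<inter> {x \<in> closed_simplex T. \<mu> x \<le> 1/2} = A"
      by (auto simp: A_def)
    ultimately show "continuous_map (subtopology (top_of_set (closed_simplex T))
        {x \<in> topspace (top_of_set (closed_simplex T)). \<mu> x \<le> 1/2}) Z (\<lambda>x. H (2 * \<mu> x, g (y x)))"
      by (simp add: subtopology_subtopology)
  qed (use a H1 in \<open>auto simp: mult.commute\<close>)
  moreover have "h x = g x" if "x \<in> closed_simplex T" "i \<in> T" "x i = 0" for x i
  proof -
    have "mn x = 0" using mn_le[of i x] mn_ge[of x] that by simp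
    moreover from this have "y x = x"
      using that by (auto simp: y_def \<mu>_def closed_simplex_def fun_eq_iff)
    ultimately show ?thesis by (simp add: h_def \<mu>_def H0)
  qed
  ultimately show thesis using that by blast
qed

text \<open>Induction removes a maximal simplex \<open>T\<close>. Its boundary lies in the remaining
  faces, where monotonicity of \<open>\<Phi>\<close> forces the values into \<open>\<Phi> T\<close>;
  contractibility of that set then fills in \<open>T\<close>.\<close>

lemma exists_map_carried_by_contractible:
  fixes \<T> :: "'i set set" and \<Phi> :: "'i set \<Rightarrow> 'a set"
  assumes "finite \<T>" and "\<And>T. T \<in> \<T> \<Longrightarrow> finite T \<and> T \<noteq> {}"
    and "\<And>T U. \<lbrakk>T \<in> \<T>; U \<subseteq> T; U \<noteq> {}\<rbrakk> \<Longrightarrow> U \<in> \<T>"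
    and "\<And>T. T \<in> \<T> \<Longrightarrow> contractible_space (subtopology X (\<Phi> T))"
    and "\<And>T. T \<in> \<T> \<Longrightarrow> topspace X \<inter> \<Phi> T \<noteq> {}"
    and "\<And>T U. \<lbrakk>T \<in> \<T>; U \<subseteq> T; U \<noteq> {}\<rbrakk> \<Longrightarrow> \<Phi> U \<subseteq> \<Phi> T"
  shows "\<exists>g. continuous_map (top_of_set (\<Union>T\<in>\<T>. closed_simplex T)) X g \<and>
    (\<forall>T\<in>\<T>. g ` closed_simplex T \<subseteq> \<Phi> T)"
  using assms
proof (induction "card \<T>" arbitrary: \<T>)
  case 0
  then show ?case by (simp add: continuous_map_def)
next
  case (Suc k)
  have "\<T> \<noteq> {}" using Suc.hyps(2) by auto
  \<comment> \<open>Maximality keeps the rest closed under nonempty subsets and makes it meet the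
    simplex of \<open>T\<close> only in its boundary.\<close>
  then obtain T where T: "T \<in> \<T>" and T_max: "\<And>U. \<lbrakk>U \<in> \<T>; T \<subseteq> U\<rbrakk> \<Longrightarrow> T = U"
    using finite_has_maximal[OF \<open>finite \<T>\<close>] by blast
  define \<S> where "\<S> = \<T> - {T}"
  define P where "P = (\<Union>T\<in>\<S>. closed_simplex T)"
  have \<T>: "\<T> = insert T \<S>" using T by (auto simp: \<S>_def)
  have finT: "finite T" "T \<noteq> {}" using Suc.prems(2) T by auto
  have "finite \<S>" using Suc.prems(1) by (simp add: \<S>_def)
  have "\<exists>g. continuous_map (top_of_set (\<Union>T\<in>\<S>. closed_simplex T)) X g \<and>
    (\<forall>T\<in>\<S>. g ` closed_simplex T \<subseteq> \<Phi> T)"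
  proof (rule Suc.hyps)
    show "k = card \<S>" using Suc.hyps(2) T by (simp add: \<S>_def)
    show "finite \<S>" by fact
    show "U \<in> \<S>" if "V \<in> \<S>" "U \<subseteq> V" "U \<noteq> {}" for U V
      using that Suc.prems(3)[of V U] T_max[of V] by (auto simp: \<S>_def)
    show "\<Phi> U \<subseteq> \<Phi> V" if "V \<in> \<S>" "U \<subseteq> V" "U \<noteq> {}" for U V
      using that Suc.prems(6)[of V U] by (auto simp: \<S>_def)
  qed (use Suc.prems(2,4,5) in \<open>auto simp: \<S>_def\<close>)
  then obtain g where g: "continuous_map (top_of_set P) X g"
    and g_in: "\<And>U. U \<in> \<S> \<Longrightarrow> g ` closed_simplex U \<subseteq> \<Phi> U"
    by (auto simp: P_def)
  define B where "B = {x\<in>closed_simplex T. \<exists>i\<in>T. x i = 0}"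
  have facet: "\<exists>U\<in>\<S>. x \<in> closed_simplex U \<and> U \<subseteq> T \<and> U \<noteq> {}" if x: "x \<in> B" for x
  proof -
    obtain i where i: "i \<in> T" "x i = 0" "x \<in> closed_simplex T" using x by (auto simp: B_def)
    then have xU: "x \<in> closed_simplex (T - {i})"
      using closed_simplex_subface[OF finT(1) i(3), of "T - {i}"] by auto
    then have "T - {i} \<noteq> {}" by (metis closed_simplex_empty empty_iff)
    then have "T - {i} \<in> \<S>" using Suc.prems(3)[OF T, of "T - {i}"] i by (auto simp: \<S>_def)
    with xU \<open>T - {i} \<noteq> {}\<close> show ?thesis by blast
  qed
  have "B \<subseteq> P" using facet by (auto simp: P_def)
  moreover have "g x \<in> \<Phi> T" if "x \<in> B" for x
    using facet[OF that] g_in Suc.prems(6)[OF T] by blast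
  ultimately have "continuous_map (top_of_set B) (subtopology X (\<Phi> T)) g"
    using continuous_map_from_subtopology_mono[OF g]
    by (auto simp: continuous_map_in_subtopology)
  then obtain h where h: "continuous_map (top_of_set (closed_simplex T)) (subtopology X (\<Phi> T)) h"
    and hg: "\<And>x i. \<lbrakk>x \<in> closed_simplex T; i \<in> T; x i = 0\<rbrakk> \<Longrightarrow> h x = g x"
    using continuous_map_extend_over_simplex[OF finT Suc.prems(4)[OF T]] Suc.prems(5)[OF T]
    unfolding B_def by auto
  \<comment> \<open>By maximality \<open>U\<close> omits some vertex of \<open>T\<close>; there
    \<open>x\<close> has coordinate 0, so \<open>x\<close> is a boundary point.\<close>
  have agree: "h x = g x" if xT: "x \<in> closed_simplex T" and xP: "x \<in> P" for x
  proof -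
    obtain U where U: "U \<in> \<S>" "x \<in> closed_simplex U" using xP by (auto simp: P_def)
    then have "\<not> T \<subseteq> U" using T_max[of U] by (auto simp: \<S>_def)
    then obtain i where "i \<in> T" "x i = 0" using U by (auto simp: closed_simplex_def)
    with xT show ?thesis by (rule hg)
  qed
  define f where "f x = (if x \<in> closed_simplex T then h x else g x)" for x
  have f_P: "f x = g x" if "x \<in> P" for x using agree that by (auto simp: f_def)
  have "closed P" unfolding P_def using \<open>finite \<S>\<close> closed_closed_simplex by auto
  have union: "(\<Union>T\<in>\<T>. closed_simplex T) = closed_simplex T \<union> P"
    by (auto simp: \<T> P_def)
  have "continuous_map (top_of_set (closed_simplex T \<union> P)) X f"
  proof (rule pasting_lemma_closed[where I = "UNIV::bool set"
        and T = "\<lambda>b. if b then closed_simplex T else P" and f = "\<lambda>b. if b then h else g"])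
    show "closedin (top_of_set (closed_simplex T \<union> P)) (if b then closed_simplex T else P)" for b
      using \<open>closed P\<close> closed_closed_simplex[of T] by (auto intro: closed_subset)
    show "continuous_map (subtopology (top_of_set (closed_simplex T \<union> P))
        (if b then closed_simplex T else P)) X (if b then h else g)" for b
      using g h by (auto simp: subtopology_subtopology continuous_map_in_subtopology
          Int_absorb1 Int_absorb2 Un_Int_distrib2)
    show "\<exists>b. b \<in> UNIV \<and> x \<in> (if b then closed_simplex T else P) \<and>
        f x = (if b then h else g) x"
      if "x \<in> topspace (top_of_set (closed_simplex T \<union> P))" for x
      using that by (cases "x \<in> closed_simplex T") (auto simp: f_def)
  qed (use agree in \<open>auto split: if_splits\<close>)
  moreover have "f ` closed_simplex U \<subseteq> \<Phi> U" if "U \<in> \<T>" for U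
  proof (cases "U = T")
    case True
    then show ?thesis
      using continuous_map_image_subset_topspace[OF h] by (auto simp: f_def)
  next
    case False
    then have "U \<in> \<S>" using that by (auto simp: \<S>_def)
    moreover from this have "closed_simplex U \<subseteq> P" by (auto simp: P_def)
    ultimately show ?thesis using g_in f_P by fastforce
  qed
  ultimately show ?case unfolding union by blast
qed

section \<open>The standard simplex as a convex retract of Euclidean space\<close>

lemma Euclidean_space_retraction_onto_simplex:
  assumes "m > 0"
  obtains r where "continuous_map (Euclidean_space m) (top_of_set (closed_simplex {..<m})) r"
    and "\<And>x. x \<in> closed_simplex {..<m} \<Longrightarrow> r x = x"
proof
  define s where "s x = (\<Sum>i<m. \<bar>x i\<bar>)" for x :: "nat \<Rightarrow> real"
  \<comment> \<open>After taking absolute values, a total below 1 is filled up equally over the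
    \<open>m\<close> coordinates and a total above 1 is scaled down. On the simplex
    \<open>s x = 1\<close>, so nothing changes; the denominator is always at least 1.\<close>
  define r where "r x = (\<lambda>i. if i < m then (\<bar>x i\<bar> + max 0 (1 - s x) / m) / max 1 (s x) else 0)"
    for x :: "nat \<Rightarrow> real"
  have top: "Euclidean_space m = top_of_set {x. \<forall>i\<ge>m. x i = 0}"
    by (simp add: Euclidean_space_def euclidean_product_topology)
  have cont_coord: "continuous_on C (\<lambda>x. x i)" for C :: "(nat \<Rightarrow> real) set" and i
    by (rule continuous_on_product_then_coordinatewise) (rule continuous_on_id)
  have max1: "max 1 t \<noteq> 0" for t :: real by (simp add: max_def)
  have "continuous_on C (\<lambda>x. r x i)" for C i
    unfolding r_def s_def
    by (cases "i < m") (auto intro!: continuous_intros continuous_on_max cont_coord max1)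
  then have "continuous_on C r" for C
    by (rule continuous_on_coordinatewise_then_product)
  moreover have "r x \<in> closed_simplex {..<m}" for x
  proof -
    have "sum (r x) {..<m} = (\<Sum>i<m. \<bar>x i\<bar> + max 0 (1 - s x) / m) / max 1 (s x)"
      by (simp add: r_def sum_divide_distrib)
    also have "(\<Sum>i<m. \<bar>x i\<bar> + max 0 (1 - s x) / m) = s x + max 0 (1 - s x)"
      using assms by (simp add: sum.distrib s_def)
    also have "\<dots> / max 1 (s x) = 1" by (auto simp: max_def)
    finally show ?thesis by (auto simp: closed_simplex_def r_def)
  qed
  ultimately show "continuous_map (Euclidean_space m) (top_of_set (closed_simplex {..<m})) r"
    by (auto simp: top continuous_map_in_subtopology)
  show "r x = x" if "x \<in> closed_simplex {..<m}" for x
    using that by (auto simp: r_def s_def closed_simplex_def fun_eq_iff)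
qed

lemma convex_in_Euclidean_closed_simplex:
  assumes "T \<subseteq> {..<m}"
  shows "convex_in_Euclidean m (closed_simplex T)"
  unfolding convex_in_Euclidean_def
proof (intro conjI ballI allI impI)
  show "closed_simplex T \<subseteq> topspace (Euclidean_space m)"
    using assms by (auto simp: closed_simplex_def topspace_Euclidean_space)
  fix x y and u v :: real
  assume xy: "x \<in> closed_simplex T" "y \<in> closed_simplex T" and uv: "0 \<le> u" "0 \<le> v" "u + v = 1"
  have "(\<Sum>i\<in>T. u * x i + v * y i) = u * sum x T + v * sum y T"
    by (simp add: sum.distrib sum_distrib_left)
  with xy uv show "(\<lambda>i. u * x i + v * y i) \<in> closed_simplex T"
    by (simp add: closed_simplex_def)
qed

section \<open>Labelling simplex vertices by the faces of \<open>K\<close>\<close>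

theorem proposition3:
  fixes Y :: "'v set set" and d n :: nat
    and S :: "nat \<Rightarrow> ('v \<Rightarrow> real) set" and K :: "nat set set"
  assumes "simplicial_complex_abs Y" and "locally_finite_complex Y" and "complex_dim Y d"
    and "contractible_space (polyhedron_top Y)"
    and "good_cover (polyhedron_top Y) n S"
    and "simplicial_complex_abs K" and "vertex_set K = {1..n}"
    and "K \<subseteq> nerve n S"
  shows "\<exists>(m::nat) (C :: nat \<Rightarrow> (nat \<Rightarrow> real) set) (f :: (nat \<Rightarrow> real) \<Rightarrow> ('v \<Rightarrow> real)).
           (\<forall>i\<in>{1..n}. convex_in_Euclidean m (C i)) \<and>
           continuous_map (Euclidean_space m) (polyhedron_top Y) f \<and>
           nerve n C = K \<and>
           (\<forall>i\<in>{1..n}. f ` C i \<subseteq> S i)"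
proof -
  let ?X = "polyhedron_top Y"
  have K_sub: "\<rho> \<subseteq> {1..n}" and K_ne: "(\<Inter>i\<in>\<rho>. S i) \<noteq> {}" if "\<rho> \<in> K" for \<rho>
    using that assms(8) by (auto simp: nerve_def)
  have K_empty: "{} \<in> K" and K_down: "\<And>\<rho> \<tau>. \<lbrakk>\<rho> \<in> K; \<tau> \<subseteq> \<rho>\<rbrakk> \<Longrightarrow> \<tau> \<in> K"
    using assms(6) unfolding simplicial_complex_abs_def by blast+
  have finK: "finite K"
    using K_sub by (intro finite_subset[of K "Pow {1..n}"]) auto
  \<comment> \<open>Contractibility alone admits the empty space; a face of dimension
    \<open>d\<close> rules it out.\<close>
  obtain \<sigma> where "\<sigma> \<in> Y" "card \<sigma> = d + 1" using assms(3) by (auto simp: complex_dim_def)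
  then have "closed_simplex \<sigma> \<noteq> {}"
    by (subst closed_simplex_eq_empty_iff) (auto intro: card_ge_0_finite)
  with \<open>\<sigma> \<in> Y\<close> have X_ne: "topspace ?X \<noteq> {}" by (auto simp: topspace_polyhedron_top)

  \<comment> \<open>The empty face is counted too, so \<open>m > 0\<close> even when
    \<open>n = 0\<close>.\<close>
  define m where "m = card K"
  have "m > 0" using K_empty finK by (auto simp: m_def card_gt_0_iff)
  obtain e where e: "bij_betw e {..<m} K"
    using ex_bij_betw_nat_finite[OF finK] unfolding m_def atLeast0LessThan by blast
  have eK: "e j \<in> K" if "j < m" for j using e that by (auto simp: bij_betw_def)
  \<comment> \<open>The empty intersection would be \<open>UNIV\<close>, which is not confined to
    the polyhedron, so the empty face gets the whole polyhedron instead.\<close>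
  define Z where "Z \<rho> = (if \<rho> = {} then topspace ?X else \<Inter>i\<in>\<rho>. S i)" for \<rho>
  have Z_contr: "contractible_space (subtopology ?X (Z \<rho>))" if "\<rho> \<in> K" for \<rho>
    using assms(4,5) K_sub[OF that] K_ne[OF that] unfolding good_cover_def Z_def
    by (auto simp: subtopology_topspace)
  have Z_sub: "Z \<rho> \<subseteq> topspace ?X" if "\<rho> \<in> K" for \<rho>
  proof (cases "\<rho> = {}")
    case False
    then obtain i where i: "i \<in> \<rho>" by blast
    then have "compactin ?X (S i)"
      using K_sub[OF that] assms(5) unfolding good_cover_def by blast
    then have "S i \<subseteq> topspace ?X" by (rule compactin_subset_topspace)
    moreover have "Z \<rho> \<subseteq> S i" using i by (auto simp: Z_def)
    ultimately show ?thesis by (rule order_trans[rotated])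
  qed (simp add: Z_def)
  have Z_ne: "Z \<rho> \<noteq> {}" if "\<rho> \<in> K" for \<rho>
    using K_ne[OF that] X_ne by (auto simp: Z_def)
  have Z_mono: "Z \<rho> \<subseteq> Z \<tau>" if "\<tau> \<subseteq> \<rho>" "\<rho> \<in> K" for \<rho> \<tau>
  proof (cases "\<tau> = {}")
    case True
    then show ?thesis using Z_sub[OF that(2)] by (simp add: Z_def)
  next
    case False
    then show ?thesis using that(1) by (auto simp: Z_def)
  qed
  define \<T> where "\<T> = {T. T \<subseteq> {..<m} \<and> T \<noteq> {}}"
  \<comment> \<open>The intersection lies inside any one label \<open>e j\<close>, itself a face of
    \<open>K\<close>.\<close>
  have common_K: "(\<Inter>j\<in>T. e j) \<in> K" if T: "T \<in> \<T>" for T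
  proof -
    obtain j where "j \<in> T" "j < m" using T unfolding \<T>_def by blast
    then show ?thesis by (intro K_down[OF eK[of j]]) auto
  qed
  have full: "{..<m} \<in> \<T>" using \<open>m > 0\<close> by (auto simp: \<T>_def)
  have union: "(\<Union>T\<in>\<T>. closed_simplex T) = closed_simplex {..<m}"
  proof
    show "(\<Union>T\<in>\<T>. closed_simplex T) \<subseteq> closed_simplex {..<m}"
      by (intro UN_least closed_simplex_mono) (auto simp: \<T>_def)
  qed (use full in blast)
  have "\<exists>g. continuous_map (top_of_set (\<Union>T\<in>\<T>. closed_simplex T)) ?X g \<and>
    (\<forall>T\<in>\<T>. g ` closed_simplex T \<subseteq> Z (\<Inter>j\<in>T. e j))"
  proof (rule exists_map_carried_by_contractible)
    show "finite \<T>" unfolding \<T>_def by auto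
    show "finite T \<and> T \<noteq> {}" if "T \<in> \<T>" for T
      using that finite_subset by (auto simp: \<T>_def)
    show "U \<in> \<T>" if "T \<in> \<T>" "U \<subseteq> T" "U \<noteq> {}" for T U
      using that by (auto simp: \<T>_def)
    show "topspace ?X \<inter> Z (\<Inter>j\<in>T. e j) \<noteq> {}" if "T \<in> \<T>" for T
      using Z_sub Z_ne common_K[OF that] by blast
    \<comment> \<open>Two reversals cancel: fewer vertices have a larger common label, and a larger
      label has a smaller \<open>Z\<close>.\<close>
    show "Z (\<Inter>j\<in>U. e j) \<subseteq> Z (\<Inter>j\<in>T. e j)" if "T \<in> \<T>" "U \<subseteq> T" "U \<noteq> {}" for T U
      using that by (intro Z_mono common_K) (auto simp: \<T>_def)
  qed (use Z_contr common_K in blast)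
  then obtain g where g: "continuous_map (top_of_set (closed_simplex {..<m})) ?X g"
    and g_in: "\<And>T. T \<in> \<T> \<Longrightarrow> g ` closed_simplex T \<subseteq> Z (\<Inter>j\<in>T. e j)"
    unfolding union by blast
  obtain r where r: "continuous_map (Euclidean_space m) (top_of_set (closed_simplex {..<m})) r"
    and r_id: "\<And>x. x \<in> closed_simplex {..<m} \<Longrightarrow> r x = x"
    using Euclidean_space_retraction_onto_simplex[OF \<open>m > 0\<close>] by blast

  define C where "C i = closed_simplex {j\<in>{..<m}. i \<in> e j}" for i
  have "convex_in_Euclidean m (C i)" for i
    unfolding C_def by (rule convex_in_Euclidean_closed_simplex) auto
  moreover have "continuous_map (Euclidean_space m) ?X (g \<circ> r)"
    using r g by (rule continuous_map_compose)
  moreover have "nerve n C = K"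
  proof -
    have "(\<Inter>i\<in>\<tau>. C i) \<noteq> {} \<longleftrightarrow> \<tau> \<in> K" for \<tau>
    proof (cases "\<tau> = {}")
      case False
      then have "(\<Inter>i\<in>\<tau>. C i) = closed_simplex {j\<in>{..<m}. \<forall>i\<in>\<tau>. i \<in> e j}"
        unfolding C_def by (intro INT_closed_simplex) auto
      then have "(\<Inter>i\<in>\<tau>. C i) \<noteq> {} \<longleftrightarrow> (\<exists>j<m. \<tau> \<subseteq> e j)"
        by (auto simp: closed_simplex_eq_empty_iff)
      \<comment> \<open>Labels are faces and \<open>K\<close> is closed under subsets; conversely
        each face of \<open>K\<close> is itself a label.\<close>
      also have "\<dots> \<longleftrightarrow> \<tau> \<in> K"
        using e K_down eK by (metis bij_betw_iff_bijections lessThan_iff order_refl)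
      finally show ?thesis .
    qed (use K_empty in auto)
    then show ?thesis using K_sub by (auto simp: nerve_def)
  qed
  moreover have "(g \<circ> r) ` C i \<subseteq> S i" for i
  proof -
    let ?T = "{j\<in>{..<m}. i \<in> e j}"
    have "C i \<subseteq> closed_simplex {..<m}"
      unfolding C_def by (intro closed_simplex_mono) auto
    then have eq: "(g \<circ> r) ` C i = g ` C i" by (intro image_cong) (auto simp: r_id)
    show ?thesis
    proof (cases "?T = {}")
      \<comment> \<open>Here \<open>i\<close> ranges over all naturals; if no label contains it,
        \<open>C i\<close> is empty.\<close>
      case True
      then show ?thesis by (simp add: C_def del: Collect_empty_eq)
    next
      case False
      then have "g ` C i \<subseteq> Z (\<Inter>j\<in>?T. e j)"
        unfolding C_def by (intro g_in) (auto simp: \<T>_def)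
      \<comment> \<open>All labels in \<open>?T\<close> contain \<open>i\<close>, so their
        intersection is nonempty and \<open>S i\<close> is among the sets intersected in
        \<open>Z\<close>.\<close>
      also have "\<dots> \<subseteq> S i" by (auto simp: Z_def)
      finally show ?thesis unfolding eq .
    qed
  qed
  ultimately show ?thesis
    by (intro exI[of _ m] exI[of _ C] exI[of _ "g \<circ> r"]) simp
qed

end
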